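(* Let $X$, $Y$ be two Polish spaces, let $(\mu_n)$ be a sequence in $\mathcal P(X)$, let $(a_n)$ be a sequence of strictly positive reals with $\lim_na_n=+\infty$, and for $n\in\mathbb N$ let $\theta_n,\theta\colon X\to Y$ be measurable maps. Assume that $\theta_n\to\theta$ uniformly on compact sets. Define $\gamma_n=\mu_n\circ\theta_n^{-1}\in\mathcal P(Y)$. For $y\in Y$ set $$\underline\Lambda^y:=\lim_{\delta\downarrow0}\mathrm{Interior}\big(\theta^{-1}(B_\delta(y))\big),\qquad \overline\Lambda^y:=\lim_{\delta\downarrow0}\mathrm{Closure}\big(\theta^{-1}(B_\delta(y))\big).$$ (i) If $(\mu_n)$ satisfies a large deviations lower bound with speed $(a_n)$ and lower semicontinuous rate $\overline I\colon X\to[0,+\infty]$, then $(\gamma_n)$ satisfies a large deviations lower bound with the same speed and rate $\overline J\colon Y\to[0,+\infty]$, $\overline J(y):=\inf_{x\in\underline\Lambda^y}\overline I(x)$. (ii) If $(\mu_n)$ is exponentially tight with speed $(a_n)$ and satisfies a large deviations upper bound with speed $(a_n)$ and lower semicontinuous rate $\underline I\colon X\to[0,+\infty]$, then $(\gamma_n)$ satisfies a large deviations weak upper bound with the same speed and rate $\underline J\colon Y\to[0,+\infty]$, $\underline J(y):=\inf_{x\in\overline\Lambda^y}\underline I(x)$. In particular, $\overline\Lambda^y\supset\theta^{-1}(y)\supset\underline\Lambda^y$, with equality holding if $\theta$ is continuous.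
   Context: $\mathcal P(X)$ is the space of Borel probability measures on $X$ with the narrow (weak) topology. A compatible distance on $Y$ is fixed; $B_\delta(y)$ is the open ball of radius $\delta$ centered at $y$, and uniform convergence is with respect to this distance. The sets $\mathrm{Interior}(\theta^{-1}(B_\delta(y)))$ and $\mathrm{Closure}(\theta^{-1}(B_\delta(y)))$ decrease as $\delta\downarrow0$, and the limit of a decreasing family of sets is its intersection. Convention: $\inf\emptyset=+\infty$. A sequence $(\mu_n)$ satisfies, with speed $(a_n)$ and rate $I$: a large deviations lower bound iff $\varliminf_n\frac1{a_n}\log\mu_n(O)\ge-\inf_{x\in O}I(x)$ for each open $O$; a large deviations weak upper bound iff $\varlimsup_n\frac1{a_n}\log\mu_n(K)\le-\inf_{x\in K}I(x)$ for each compact $K$; a large deviations upper bound iff $\varlimsup_n\frac1{a_n}\log\mu_n(C)\le-\inf_{x\in C}I(x)$ for each closed $C$. $(\mu_n)$ is exponentially tight with speed $(a_n)$ iff $\inf_{K\subset X\text{ compact}}\varlimsup_n\frac1{a_n}\log\mu_n(K^c)=-\infty$. *)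

theory Defs
  imports "HOL-Probability.Probability"
begin

definition borel_prob :: "'a::topological_space measure \<Rightarrow> bool" where
  "borel_prob M \<longleftrightarrow> prob_space M \<and> sets M = sets borel"

definition lower_semicontinuous :: "('a::topological_space \<Rightarrow> ennreal) \<Rightarrow> bool" where
  "lower_semicontinuous f \<longleftrightarrow> (\<forall>c. open {x. c < f x})"

text \<open>The logarithm on \<open>[0, \<infinity>)\<close> with the convention \<open>log 0 = -\<infinity>\<close> (the library has \<open>ln 0 = 0\<close>).\<close>

definition eln :: "real \<Rightarrow> ereal" where
  "eln p = (if p = 0 then -\<infinity> else ereal (ln p))"

definition scaled_log ::
  "(nat \<Rightarrow> real) \<Rightarrow> (nat \<Rightarrow> 'a measure) \<Rightarrow> 'a set \<Rightarrow> nat \<Rightarrow> ereal" where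
  "scaled_log a \<mu> A n = ereal (1 / a n) * eln (measure (\<mu> n) A)"

text \<open>
  In the following definitions rates take values in \<^typ>\<open>ennreal\<close>, so the infimum over the
  empty set is \<open>\<infinity>\<close>; it is moved to \<^typ>\<open>ereal\<close> only to be negated.
\<close>

definition ld_lower_bound ::
  "(nat \<Rightarrow> real) \<Rightarrow> (nat \<Rightarrow> 'a::topological_space measure) \<Rightarrow> ('a \<Rightarrow> ennreal) \<Rightarrow> bool" where
  "ld_lower_bound a \<mu> I \<longleftrightarrow>
     (\<forall>U. open U \<longrightarrow> liminf (scaled_log a \<mu> U) \<ge> - enn2ereal (INF x\<in>U. I x))"

definition ld_weak_upper_bound ::
  "(nat \<Rightarrow> real) \<Rightarrow> (nat \<Rightarrow> 'a::topological_space measure) \<Rightarrow> ('a \<Rightarrow> ennreal) \<Rightarrow> bool" where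
  "ld_weak_upper_bound a \<mu> I \<longleftrightarrow>
     (\<forall>K. compact K \<longrightarrow> limsup (scaled_log a \<mu> K) \<le> - enn2ereal (INF x\<in>K. I x))"

definition ld_upper_bound ::
  "(nat \<Rightarrow> real) \<Rightarrow> (nat \<Rightarrow> 'a::topological_space measure) \<Rightarrow> ('a \<Rightarrow> ennreal) \<Rightarrow> bool" where
  "ld_upper_bound a \<mu> I \<longleftrightarrow>
     (\<forall>C. closed C \<longrightarrow> limsup (scaled_log a \<mu> C) \<le> - enn2ereal (INF x\<in>C. I x))"

definition exponentially_tight ::
  "(nat \<Rightarrow> real) \<Rightarrow> (nat \<Rightarrow> 'a::topological_space measure) \<Rightarrow> bool" where
  "exponentially_tight a \<mu> \<longleftrightarrow>
     (INF K\<in>{K. compact K}. limsup (scaled_log a \<mu> (- K))) = -\<infinity>"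

text \<open>
  The families below decrease as \<open>\<delta> \<down> 0\<close>; their limit is the intersection.
\<close>

definition Lambda_lower :: "('a::topological_space \<Rightarrow> 'b::metric_space) \<Rightarrow> 'b \<Rightarrow> 'a set" where
  "Lambda_lower \<theta> y = (\<Inter>\<delta>\<in>{0<..}. interior (\<theta> -` ball y \<delta>))"

definition Lambda_upper :: "('a::topological_space \<Rightarrow> 'b::metric_space) \<Rightarrow> 'b \<Rightarrow> 'a set" where
  "Lambda_upper \<theta> y = (\<Inter>\<delta>\<in>{0<..}. closure (\<theta> -` ball y \<delta>))"

end

theory Submission
  imports Defs
begin

text \<open>
  The rate of the image measures near \<open>y\<close> is governed by the points of \<open>X\<close> that \<open>\<theta>\<close> sends close to
  \<open>y\<close>: robustly so for the lower bound (interiors), and up to limits for the upper bound (closures).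

  \<^emph>\<open>Lower bound.\<close> A convergent sequence together with its limit is compact, so uniform convergence
  on compact sets in a first countable space is already locally uniform (lemma
  \<open>uniform_on_compact_imp_locally_uniform\<close>). Therefore a point \<open>x\<close> of \<^term>\<open>Lambda_lower \<theta> y\<close>, with
  \<open>y\<close> in an open set \<open>U\<close>, has one open neighbourhood \<open>V\<close> that all late \<open>\<theta>\<^sub>n\<close> map into \<open>U\<close>. The mass
  that \<open>\<mu>\<^sub>n\<close> gives to \<open>V\<close> is a lower bound for the mass that the image gives to \<open>U\<close>, at exponential
  cost at most \<open>I x\<close>.

  \<^emph>\<open>Upper bound.\<close> Exponential tightness lets one discard, at any prescribed exponential cost, the
  complement of a compact \<open>H\<close>. If \<open>m\<close> is below the claimed rate on a compact \<open>K\<close>, then for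
  every \<open>y \<in> K\<close> the compact sets \<open>H \<inter> {I \<le> m} \<inter> closure (\<theta>\<^sup>-\<^sup>1 (ball y \<delta>))\<close> decrease to the empty set
  as \<open>\<delta>\<close> decreases to \<open>0\<close>, so one of them is empty. Finitely many of the
  corresponding balls, with halved radii, cover \<open>K\<close>; the other halves absorb the uniform distance
  between \<open>\<theta>\<^sub>n\<close> and \<open>\<theta>\<close> on \<open>H\<close>. So \<open>H \<inter> \<theta>\<^sub>n\<^sup>-\<^sup>1 K\<close> eventually lies in one closed set on which
  \<open>I > m\<close>. The two remaining masses are added with \<open>log (p + q) \<le> log 2 + max (log p) (log q)\<close>, where
  the summand \<open>log 2\<close> disappears after division by \<open>a\<^sub>n\<close>.
\<close>

section \<open>Logarithmic masses\<close>

lemma eln_mono: "0 \<le> p \<Longrightarrow> p \<le> q \<Longrightarrow> eln p \<le> eln q"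
  by (auto simp: eln_def)

lemma scaled_log_mono:
  assumes "a n > 0" "measure (\<mu> n) A \<le> measure (\<nu> n) B"
  shows "scaled_log a \<mu> A n \<le> scaled_log a \<nu> B n"
  unfolding scaled_log_def
  using assms by (intro ereal_mult_left_mono eln_mono) auto

lemma scaled_log_le_0:
  assumes "a n > 0" "prob_space (\<mu> n)"
  shows "scaled_log a \<mu> A n \<le> 0"
proof -
  have "eln (measure (\<mu> n) A) \<le> eln 1"
    using prob_space.prob_le_1[OF assms(2)] by (intro eln_mono) auto
  also have "eln 1 = 0"
    by (simp add: eln_def)
  finally have "scaled_log a \<mu> A n \<le> ereal (1 / a n) * 0"
    unfolding scaled_log_def using assms(1) by (intro ereal_mult_left_mono) auto
  then show ?thesis by simp
qed

lemma eln_add_le: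
  assumes "0 \<le> p" "0 \<le> q"
  shows "eln (p + q) \<le> ereal (ln 2) + max (eln p) (eln q)"
proof -
  have double: "eln (p + q) \<le> ereal (ln 2) + eln q" if "0 \<le> p" "p \<le> q" for p q :: real
  proof (cases "q = 0")
    case True
    with that show ?thesis by (simp add: eln_def)
  next
    case False
    have "eln (p + q) \<le> eln (2 * q)"
      using that by (intro eln_mono) auto
    also have "\<dots> = ereal (ln 2) + eln q"
      using False that by (simp add: eln_def ln_mult)
    finally show ?thesis .
  qed
  show ?thesis
  proof (cases "p \<le> q")
    case True
    then have "max (eln p) (eln q) = eln q"
      using eln_mono[OF assms(1)] by (simp add: max_absorb2)
    then show ?thesis using double[OF assms(1) True] by simp
  next
    case False
    then have "max (eln p) (eln q) = eln p"
      using eln_mono[OF assms(2), of p] by (simp add: max_absorb1)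
    then show ?thesis using double[OF assms(2), of p] False by (simp add: add.commute)
  qed
qed

text \<open>
  The largest exponent wins: a sum of two masses decays at the slower of the two rates, because
  the factor \<open>2\<close> lost in replacing the sum by twice the maximum is invisible at speed \<open>a\<close>.
\<close>

lemma limsup_scaled_log_add_le:
  assumes a_pos: "\<And>n. a n > 0" and a_lim: "filterlim a at_top sequentially"
    and le: "\<forall>\<^sub>F n in sequentially. measure (\<nu> n) A \<le> measure (\<mu> n) B + measure (\<mu> n) C"
    and B: "limsup (scaled_log a \<mu> B) \<le> s" and C: "limsup (scaled_log a \<mu> C) \<le> s"
  shows "limsup (scaled_log a \<nu> A) \<le> s"
proof -
  let ?M = "\<lambda>n. max (scaled_log a \<mu> B n) (scaled_log a \<mu> C n)"
  have pt: "scaled_log a \<nu> A n \<le> ereal (ln 2 / a n) + ?M n"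
    if "measure (\<nu> n) A \<le> measure (\<mu> n) B + measure (\<mu> n) C" for n
  proof -
    have "eln (measure (\<nu> n) A) \<le> ereal (ln 2) + max (eln (measure (\<mu> n) B)) (eln (measure (\<mu> n) C))"
      using eln_mono[OF _ that] eln_add_le[of "measure (\<mu> n) B" "measure (\<mu> n) C"] by fastforce
    then have "scaled_log a \<nu> A n \<le>
        ereal (1 / a n) * (ereal (ln 2) + max (eln (measure (\<mu> n) B)) (eln (measure (\<mu> n) C)))"
      unfolding scaled_log_def using a_pos[of n] by (intro ereal_mult_left_mono) auto
    also have "\<dots> = ereal (ln 2 / a n) + ereal (1 / a n) * max (eln (measure (\<mu> n) B)) (eln (measure (\<mu> n) C))"
      using ereal_distrib_left[of "ereal (ln 2)" _ "ereal (1 / a n)"] by simp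
    also have "ereal (1 / a n) * max (eln (measure (\<mu> n) B)) (eln (measure (\<mu> n) C)) = ?M n"
    proof -
      have "mono (\<lambda>x. ereal (1 / a n) * x)"
        using a_pos[of n] by (intro monoI ereal_mult_left_mono) auto
      from max_of_mono[OF this] show ?thesis
        by (simp add: scaled_log_def)
    qed
    finally show ?thesis .
  qed
  have "(\<lambda>n. ln 2 / a n) \<longlonglongrightarrow> 0"
    using a_lim by (intro tendsto_divide_0[OF tendsto_const]) (auto intro: filterlim_at_top_imp_at_infinity)
  then have log2: "(\<lambda>n. ereal (ln 2 / a n)) \<longlonglongrightarrow> 0"
    by (simp add: zero_ereal_def)
  have "limsup ?M \<le> s"
    using B C unfolding Limsup_le_iff by (auto intro: eventually_conj)
  moreover have "limsup (\<lambda>n. ereal (ln 2 / a n) + ?M n) = 0 + limsup ?M"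
    by (rule ereal_limsup_lim_add[OF log2]) simp
  moreover have "limsup (scaled_log a \<nu> A) \<le> limsup (\<lambda>n. ereal (ln 2 / a n) + ?M n)"
    using le by (intro Limsup_mono) (auto elim: eventually_mono intro: pt)
  ultimately show ?thesis by simp
qed

lemma measure_distr_borel:
  assumes "borel_prob M" "f \<in> borel_measurable borel" "A \<in> sets borel"
  shows "measure (distr M borel f) A = measure M (f -` A)"
    and "f -` A \<in> sets M"
proof -
  have s: "sets M = sets borel" and sp: "space M = UNIV"
    using assms(1) sets_eq_imp_space_eq[of M borel] by (auto simp: borel_prob_def)
  have f: "f \<in> measurable M borel"
    using assms(2) s by (simp cong: measurable_cong_sets)
  show "measure (distr M borel f) A = measure M (f -` A)"
    using measure_distr[OF f assms(3)] by (simp add: sp)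
  show "f -` A \<in> sets M"
    using measurable_sets[OF f assms(3)] by (simp add: sp)
qed

section \<open>The limit sets\<close>

lemma Lambda_lower_subset: "Lambda_lower \<theta> y \<subseteq> \<theta> -` {y}"
proof
  fix x assume "x \<in> Lambda_lower \<theta> y"
  then have "dist y (\<theta> x) < \<delta>" if "\<delta> > 0" for \<delta>
    using that interior_subset[of "\<theta> -` ball y \<delta>"] by (auto simp: Lambda_lower_def)
  then have "dist y (\<theta> x) \<le> 0"
    by (meson less_irrefl not_le)
  then show "x \<in> \<theta> -` {y}" by simp
qed

lemma subset_Lambda_upper: "\<theta> -` {y} \<subseteq> Lambda_upper \<theta> y"
proof
  fix x assume "x \<in> \<theta> -` {y}"
  then have "x \<in> \<theta> -` ball y \<delta>" if "\<delta> > 0" for \<delta>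
    using that by simp
  then show "x \<in> Lambda_upper \<theta> y"
    unfolding Lambda_upper_def using closure_subset by fastforce
qed

lemma Lambda_lower_continuous:
  assumes "continuous_on UNIV \<theta>"
  shows "Lambda_lower \<theta> y = \<theta> -` {y}"
proof -
  have "open (\<theta> -` ball y \<delta>)" for \<delta>
    using assms by (simp add: open_vimage)
  then have "\<theta> -` {y} \<subseteq> Lambda_lower \<theta> y"
    by (auto simp: Lambda_lower_def interior_open)
  with Lambda_lower_subset show ?thesis by blast
qed

lemma Lambda_upper_continuous:
  assumes "continuous_on UNIV \<theta>"
  shows "Lambda_upper \<theta> y = \<theta> -` {y}"
proof
  show "Lambda_upper \<theta> y \<subseteq> \<theta> -` {y}"
  proof
    fix x assume x: "x \<in> Lambda_upper \<theta> y"
    have "dist y (\<theta> x) \<le> \<delta>" if "\<delta> > 0" for \<delta>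
    proof -
      have "closed (\<theta> -` cball y \<delta>)"
        using assms by (simp add: closed_vimage)
      moreover have "\<theta> -` ball y \<delta> \<subseteq> \<theta> -` cball y \<delta>"
        by auto
      ultimately have "closure (\<theta> -` ball y \<delta>) \<subseteq> \<theta> -` cball y \<delta>"
        by (rule closure_minimal[rotated])
      with x that show ?thesis by (auto simp: Lambda_upper_def)
    qed
    then have "dist y (\<theta> x) \<le> 0"
      by (meson dense not_le)
    then show "x \<in> \<theta> -` {y}" by simp
  qed
qed (rule subset_Lambda_upper)

section \<open>The lower bound\<close>

text \<open>
  If no neighbourhood of \<open>x\<close> worked, there would be points \<open>z\<^sub>k \<longlonglongrightarrow> x\<close> and indices \<open>n\<^sub>k \<ge> k\<close> at which
  the distance stays at least \<open>\<epsilon>\<close>; this contradicts uniform convergence on the compact set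
  \<open>{x} \<union> {z\<^sub>k | k}\<close>.
\<close>

lemma uniform_on_compact_imp_locally_uniform:
  fixes f :: "nat \<Rightarrow> 'a::first_countable_topology \<Rightarrow> 'b::metric_space"
  assumes conv: "\<And>K. compact K \<Longrightarrow> uniform_limit K f g sequentially" and "\<epsilon> > 0"
  shows "\<exists>V. open V \<and> x \<in> V \<and> (\<forall>\<^sub>F n in sequentially. \<forall>z\<in>V. dist (f n z) (g z) < \<epsilon>)"
proof (rule ccontr)
  assume neg: "\<not> ?thesis"
  then have bad: "\<not> (\<forall>\<^sub>F n in sequentially. \<forall>z\<in>V. dist (f n z) (g z) < \<epsilon>)"
    if "open V" "x \<in> V" for V
    using neg that by blast
  obtain A :: "nat \<Rightarrow> 'a set" where A: "\<And>i. open (A i)" "\<And>i. x \<in> A i"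
      "\<And>S. open S \<Longrightarrow> x \<in> S \<Longrightarrow> \<forall>\<^sub>F i in sequentially. A i \<subseteq> S"
    using countable_basis_at_decseq[of x] by blast
  have "\<exists>n z. n \<ge> k \<and> z \<in> A k \<and> \<epsilon> \<le> dist (f n z) (g z)" for k
    using bad[OF A(1,2), of k] unfolding eventually_sequentially by (metis not_le)
  then obtain n z where nz: "\<And>k. n k \<ge> k" "\<And>k. z k \<in> A k" "\<And>k. \<epsilon> \<le> dist (f (n k) (z k)) (g (z k))"
    by metis
  have "z \<longlonglongrightarrow> x"
  proof (rule topological_tendstoI)
    fix S assume "open S" "x \<in> S"
    then show "\<forall>\<^sub>F k in sequentially. z k \<in> S"
      using A(3) nz(2) by (metis (mono_tags, lifting) eventually_mono subsetD)
  qed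
  then have "compactin euclidean (insert x (range z))"
    by (intro compactin_sequence_with_limit) auto
  then have "uniform_limit (insert x (range z)) f g sequentially"
    by (intro conv) simp
  then obtain N where "\<And>m w. m \<ge> N \<Longrightarrow> w \<in> insert x (range z) \<Longrightarrow> dist (f m w) (g w) < \<epsilon>"
    using \<open>\<epsilon> > 0\<close> unfolding uniform_limit_iff eventually_sequentially by metis
  \<comment> \<open>\<open>N\<close> also serves as the position in the sequence, since the index chosen there is at least \<open>N\<close>.\<close>
  with nz(1)[of N] nz(3)[of N] show False
    by (metis insertI2 not_le rangeI)
qed

lemma ld_lower_bound_image:
  fixes \<theta> :: "'a::first_countable_topology \<Rightarrow> 'b::metric_space"
  assumes \<mu>: "\<And>n. borel_prob (\<mu> n)" and a_pos: "\<And>n. a n > 0"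
    and meas: "\<And>n. \<theta>n n \<in> borel_measurable borel"
    and conv: "\<And>K. compact K \<Longrightarrow> uniform_limit K \<theta>n \<theta> sequentially"
    and lb: "ld_lower_bound a \<mu> I"
  shows "ld_lower_bound a (\<lambda>n. distr (\<mu> n) borel (\<theta>n n)) (\<lambda>y. INF x\<in>Lambda_lower \<theta> y. I x)"
  unfolding ld_lower_bound_def
proof (intro allI impI)
  fix U :: "'b set" assume U: "open U"
  let ?\<gamma> = "\<lambda>n. distr (\<mu> n) borel (\<theta>n n)"
  let ?L = "liminf (scaled_log a ?\<gamma> U)"
  have pt: "- enn2ereal (I x) \<le> ?L" if y: "y \<in> U" and x: "x \<in> Lambda_lower \<theta> y" for x y
  proof -
    obtain e where e: "e > 0" "ball y e \<subseteq> U"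
      using U y by (meson openE)
    define W where "W = interior (\<theta> -` ball y (e / 2))"
    obtain V where V: "open V" "x \<in> V" "\<forall>\<^sub>F n in sequentially. \<forall>z\<in>V. dist (\<theta>n n z) (\<theta> z) < e / 2"
      using uniform_on_compact_imp_locally_uniform[of \<theta>n \<theta> "e / 2" x] conv e(1) by force
    have WV: "open (W \<inter> V)" "x \<in> W \<inter> V"
      using V x e(1) by (auto simp: W_def Lambda_lower_def)
    have ev: "\<forall>\<^sub>F n in sequentially. scaled_log a \<mu> (W \<inter> V) n \<le> scaled_log a ?\<gamma> U n"
      using V(3)
    proof eventually_elim
      case (elim n)
      have "\<theta>n n z \<in> U" if "z \<in> W \<inter> V" for z
      proof -
        have "dist y (\<theta> z) < e / 2"
          using that interior_subset[of "\<theta> -` ball y (e / 2)"] by (auto simp: W_def)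
        moreover have "dist (\<theta>n n z) (\<theta> z) < e / 2"
          using elim that by blast
        ultimately have "dist y (\<theta>n n z) < e"
          by (rule dist_triangle_half_l[of _ _ _ _, simplified dist_commute])
        with e(2) show ?thesis by auto
      qed
      then have "W \<inter> V \<subseteq> \<theta>n n -` U" by auto
      moreover have "finite_measure (\<mu> n)"
        using \<mu>[of n] by (simp add: borel_prob_def prob_space_def)
      ultimately have "measure (\<mu> n) (W \<inter> V) \<le> measure (?\<gamma> n) U"
        using measure_distr_borel[OF \<mu> meas borel_open[OF U]]
        by (simp add: finite_measure.finite_measure_mono)
      then show ?case
        using a_pos by (rule scaled_log_mono[rotated])
    qed
    have "(INF z\<in>W \<inter> V. I z) \<le> I x"
      using WV(2) by (rule INF_lower)
    then have "- enn2ereal (I x) \<le> - enn2ereal (INF z\<in>W \<inter> V. I z)"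
      by (simp add: less_eq_ennreal.rep_eq)
    also have "\<dots> \<le> liminf (scaled_log a \<mu> (W \<inter> V))"
      using lb WV(1) by (auto simp: ld_lower_bound_def)
    also have "\<dots> \<le> ?L"
      by (rule Liminf_mono[OF ev])
    finally show ?thesis .
  qed
  \<comment> \<open>The pointwise bounds pass to the infimum: if it were smaller than \<open>- ?L\<close>, so would be some \<open>I x\<close>.\<close>
  have "\<not> ?L < - enn2ereal (INF y\<in>U. INF x\<in>Lambda_lower \<theta> y. I x)" (is "\<not> _ < - enn2ereal ?J")
  proof
    assume less: "?L < - enn2ereal ?J"
    then have pos: "enn2ereal ?J < - ?L"
      by (simp add: ereal_less_uminus_reorder)
    then have "0 \<le> - ?L"
      using enn2ereal_nonneg order_trans less_imp_le by blast
    then have repr: "enn2ereal (e2ennreal (- ?L)) = - ?L"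
      by (rule enn2ereal_e2ennreal)
    with pos have "?J < e2ennreal (- ?L)"
      by (simp add: less_ennreal.rep_eq)
    then obtain y x where "y \<in> U" "x \<in> Lambda_lower \<theta> y" "I x < e2ennreal (- ?L)"
      by (auto simp: INF_less_iff)
    then have "enn2ereal (I x) < - ?L"
      using repr by (simp add: less_ennreal.rep_eq)
    with pt[OF \<open>y \<in> U\<close> \<open>x \<in> Lambda_lower \<theta> y\<close>] show False
      by (metis ereal_uminus_le_reorder not_le)
  qed
  then show "- enn2ereal ?J \<le> ?L" by simp
qed

section \<open>The weak upper bound\<close>

text \<open>
  If \<open>{I \<le> m}\<close> met all the closures within the compact \<open>H\<close>, it would meet their intersection
  \<^term>\<open>Lambda_upper \<theta> y\<close>, because \<open>{I \<le> m}\<close> is closed and the closures shrink with the radius.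
\<close>

lemma rate_exceeds_near_Lambda_upper:
  fixes \<theta> :: "'a::t2_space \<Rightarrow> 'b::metric_space"
  assumes H: "compact H" and lsc: "lower_semicontinuous I"
    and m: "m < (INF x\<in>Lambda_upper \<theta> y. I x)"
  shows "\<exists>\<delta>>0. \<forall>x\<in>H. x \<in> closure (\<theta> -` ball y \<delta>) \<longrightarrow> m < I x"
proof (rule ccontr)
  assume neg: "\<not> ?thesis"
  then have bad: "\<exists>x\<in>H. x \<in> closure (\<theta> -` ball y \<delta>) \<and> I x \<le> m" if "\<delta> > 0" for \<delta>
    using neg that by (meson not_le)
  define F where "F \<delta> = closure (\<theta> -` ball y \<delta>) \<inter> - {x. m < I x}" for \<delta> :: real
  have "H \<inter> (\<Inter>\<delta>\<in>{0<..}. F \<delta>) \<noteq> {}"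
  proof (rule compact_imp_fip_image[OF H])
    show "closed (F \<delta>)" for \<delta>
      using lsc by (auto simp: F_def lower_semicontinuous_def)
  next
    fix D :: "real set" assume D: "finite D" "D \<subseteq> {0<..}"
    \<comment> \<open>The \<open>1\<close> provides a positive radius when \<open>D\<close> is empty.\<close>
    define d where "d = Min (insert 1 D)"
    have d: "d > 0" "\<And>\<delta>. \<delta> \<in> D \<Longrightarrow> d \<le> \<delta>"
      using D by (auto simp: d_def)
    obtain x where x: "x \<in> H" "x \<in> closure (\<theta> -` ball y d)" "I x \<le> m"
      using bad[OF d(1)] by blast
    have "x \<in> F \<delta>" if "\<delta> \<in> D" for \<delta>
    proof -
      have "closure (\<theta> -` ball y d) \<subseteq> closure (\<theta> -` ball y \<delta>)"
        using d(2)[OF that] by (intro closure_mono vimage_mono subset_ball)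
      with x show ?thesis by (auto simp: F_def)
    qed
    with x show "H \<inter> (\<Inter>\<delta>\<in>D. F \<delta>) \<noteq> {}" by blast
  qed
  then obtain x where x: "\<And>\<delta>. \<delta> > 0 \<Longrightarrow> x \<in> F \<delta>"
    by auto
  then have "x \<in> Lambda_upper \<theta> y"
    by (auto simp: F_def Lambda_upper_def)
  with m have "m < I x"
    by (meson INF_lower less_le_trans)
  with x[of 1] show False by (simp add: F_def)
qed

text \<open>
  The radius at which \<open>I\<close> exceeds \<open>m\<close> depends on \<open>y\<close>; compactness of \<open>K\<close> leaves finitely many radii,
  so that one set \<open>C\<close> and one tolerance for the distance between \<open>\<theta>\<^sub>n\<close> and \<open>\<theta>\<close> serve all of \<open>K\<close>.
\<close>

lemma closed_set_capturing_preimages: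
  fixes \<theta> :: "'a::t2_space \<Rightarrow> 'b::metric_space"
  assumes H: "compact H" and K: "compact K" and lsc: "lower_semicontinuous I"
    and conv: "uniform_limit H \<theta>n \<theta> sequentially"
    and m: "m < (INF y\<in>K. INF x\<in>Lambda_upper \<theta> y. I x)"
  obtains C where "closed C" "\<And>x. x \<in> C \<Longrightarrow> m < I x"
    "\<forall>\<^sub>F n in sequentially. \<theta>n n -` K \<inter> H \<subseteq> C"
proof -
  have "\<exists>\<delta>>0. \<forall>x\<in>H. x \<in> closure (\<theta> -` ball y \<delta>) \<longrightarrow> m < I x" if "y \<in> K" for y
  proof -
    have "m < (INF x\<in>Lambda_upper \<theta> y. I x)"
      using m that by (meson INF_lower less_le_trans)
    from rate_exceeds_near_Lambda_upper[OF H lsc this] show ?thesis .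
  qed
  then obtain \<delta> where \<delta>: "\<And>y. y \<in> K \<Longrightarrow> \<delta> y > 0"
      "\<And>y x. y \<in> K \<Longrightarrow> x \<in> H \<Longrightarrow> x \<in> closure (\<theta> -` ball y (\<delta> y)) \<Longrightarrow> m < I x"
    by metis
  have "K \<subseteq> (\<Union>y\<in>K. ball y (\<delta> y / 2))"
    using \<delta>(1) by force
  then obtain D where D: "D \<subseteq> K" "finite D" "K \<subseteq> (\<Union>y\<in>D. ball y (\<delta> y / 2))"
    using compactE_image[OF K, of K "\<lambda>y. ball y (\<delta> y / 2)"] by auto
  define C where "C = H \<inter> (\<Union>y\<in>D. closure (\<theta> -` ball y (\<delta> y)))"
  define e where "e = Min (insert 1 ((\<lambda>y. \<delta> y / 2) ` D))"
  have e: "e > 0"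
    using D \<delta>(1) by (auto simp: e_def)
  have e_le: "e \<le> \<delta> y / 2" if "y \<in> D" for y
    unfolding e_def using D(2) that by (intro Min_le) auto
  have "\<forall>\<^sub>F n in sequentially. \<forall>x\<in>H. dist (\<theta>n n x) (\<theta> x) < e"
    using conv e by (simp add: uniform_limit_iff)
  then have "\<forall>\<^sub>F n in sequentially. \<theta>n n -` K \<inter> H \<subseteq> C"
  proof eventually_elim
    case (elim n)
    show ?case
    proof
      fix x assume x: "x \<in> \<theta>n n -` K \<inter> H"
      then obtain y where y: "y \<in> D" "dist y (\<theta>n n x) < \<delta> y / 2"
        using D(3) by auto
      have "dist (\<theta>n n x) (\<theta> x) < \<delta> y / 2"
        using elim x e_le[OF y(1)] by fastforce
      with y(2) have "dist y (\<theta> x) < \<delta> y"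
        using dist_triangle[of y "\<theta> x" "\<theta>n n x"] by simp
      then have "x \<in> closure (\<theta> -` ball y (\<delta> y))"
        using closure_subset by fastforce
      with x y(1) show "x \<in> C" by (auto simp: C_def)
    qed
  qed
  moreover have "closed C"
    unfolding C_def using D(2) compact_imp_closed[OF H] by (intro closed_Int closed_UN) auto
  moreover have "m < I x" if "x \<in> C" for x
    using that \<delta>(2) D(1) by (auto simp: C_def)
  ultimately show ?thesis using that by blast
qed

lemma ld_weak_upper_bound_image:
  fixes \<theta> :: "'a::t2_space \<Rightarrow> 'b::metric_space"
  assumes \<mu>: "\<And>n. borel_prob (\<mu> n)" and a_pos: "\<And>n. a n > 0"
    and a_lim: "filterlim a at_top sequentially"
    and meas: "\<And>n. \<theta>n n \<in> borel_measurable borel"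
    and conv: "\<And>K. compact K \<Longrightarrow> uniform_limit K \<theta>n \<theta> sequentially"
    and lsc: "lower_semicontinuous I"
    and tight: "exponentially_tight a \<mu>" and ub: "ld_upper_bound a \<mu> I"
  shows "ld_weak_upper_bound a (\<lambda>n. distr (\<mu> n) borel (\<theta>n n)) (\<lambda>y. INF x\<in>Lambda_upper \<theta> y. I x)"
  unfolding ld_weak_upper_bound_def
proof (intro allI impI)
  fix K :: "'b set" assume K: "compact K"
  let ?\<gamma> = "\<lambda>n. distr (\<mu> n) borel (\<theta>n n)"
  let ?L = "limsup (scaled_log a ?\<gamma> K)"
  let ?J = "INF y\<in>K. INF x\<in>Lambda_upper \<theta> y. I x"
  have key: "?L \<le> - enn2ereal m" if m: "m < ?J" for m
  proof -
    have "m < \<infinity>"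
      using m by (metis infinity_ennreal_def less_le_trans top_greatest)
    then have "(INF H\<in>{H. compact H}. limsup (scaled_log a \<mu> (- H))) < - enn2ereal m"
      using tight unfolding exponentially_tight_def
      by (cases m) (auto simp: ereal_less_uminus_reorder)
    then obtain H where H: "compact H" and outside: "limsup (scaled_log a \<mu> (- H)) < - enn2ereal m"
      by (auto simp: INF_less_iff)
    obtain C where C: "closed C" "\<And>x. x \<in> C \<Longrightarrow> m < I x"
        and capture: "\<forall>\<^sub>F n in sequentially. \<theta>n n -` K \<inter> H \<subseteq> C"
      using closed_set_capturing_preimages[OF H K lsc conv[OF H] m] by blast
    have "m \<le> (INF x\<in>C. I x)"
      using C(2) by (auto intro: INF_greatest less_imp_le)
    then have "- enn2ereal (INF x\<in>C. I x) \<le> - enn2ereal m"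
      by (simp add: less_eq_ennreal.rep_eq)
    moreover have "limsup (scaled_log a \<mu> C) \<le> - enn2ereal (INF x\<in>C. I x)"
      using ub C(1) by (auto simp: ld_upper_bound_def)
    ultimately have inside: "limsup (scaled_log a \<mu> C) \<le> - enn2ereal m"
      by (rule order_trans[rotated])
    have split: "\<forall>\<^sub>F n in sequentially. measure (?\<gamma> n) K \<le> measure (\<mu> n) C + measure (\<mu> n) (- H)"
      using capture
    proof eventually_elim
      case (elim n)
      interpret finite_measure "\<mu> n"
        using \<mu>[of n] by (simp add: borel_prob_def prob_space_def)
      have sets: "C \<in> sets (\<mu> n)" "- H \<in> sets (\<mu> n)"
        using \<mu>[of n] C(1) compact_imp_closed[OF H] by (auto simp: borel_prob_def open_Compl)
      have "measure (?\<gamma> n) K = measure (\<mu> n) (\<theta>n n -` K)"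
        by (rule measure_distr_borel[OF \<mu> meas borel_compact[OF K]])
      also have "\<dots> \<le> measure (\<mu> n) (C \<union> - H)"
        using elim sets by (intro finite_measure_mono) auto
      also have "\<dots> \<le> measure (\<mu> n) C + measure (\<mu> n) (- H)"
        using sets by (rule measure_Un_le)
      finally show ?case .
    qed
    show ?thesis
      using limsup_scaled_log_add_le[OF a_pos a_lim split inside less_imp_le[OF outside]] .
  qed
  \<comment> \<open>This makes \<open>- ?L\<close> an extended nonnegative real, to which density of the order applies; it is also
    the whole bound in case \<open>?J = 0\<close>, where there is no \<open>m < ?J\<close>.\<close>
  have "?L \<le> 0"
  proof (rule Limsup_bounded)
    have "prob_space (?\<gamma> n)" for n
      using \<mu>[of n] meas[of n]
      by (intro prob_space.prob_space_distr) (auto simp: borel_prob_def cong: measurable_cong_sets)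
    then show "\<forall>\<^sub>F n in sequentially. scaled_log a ?\<gamma> K n \<le> 0"
      using a_pos by (simp add: scaled_log_le_0)
  qed
  then have repr: "enn2ereal (e2ennreal (- ?L)) = - ?L"
    by (intro enn2ereal_e2ennreal) (simp add: ereal_uminus_le_reorder)
  have "?J \<le> e2ennreal (- ?L)"
  proof (rule dense_le)
    fix m assume "m < ?J"
    from key[OF this] have "enn2ereal m \<le> - ?L"
      by (metis ereal_minus_le_minus ereal_uminus_uminus)
    then show "m \<le> e2ennreal (- ?L)"
      by (simp add: less_eq_ennreal.rep_eq repr)
  qed
  then have "enn2ereal ?J \<le> - ?L"
    by (simp add: less_eq_ennreal.rep_eq repr)
  then show "?L \<le> - enn2ereal ?J"
    by (metis ereal_minus_le_minus ereal_uminus_uminus)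
qed

section \<open>The contraction principle\<close>

theorem proposition4p4:
  fixes \<mu> :: "nat \<Rightarrow> 'a::polish_space measure"
    and a :: "nat \<Rightarrow> real"
    and \<theta>n :: "nat \<Rightarrow> 'a \<Rightarrow> 'b::{metric_space, second_countable_topology}"
    and \<theta> :: "'a \<Rightarrow> 'b"
    and \<gamma> :: "nat \<Rightarrow> 'b measure"
  assumes Y_polish: "completely_metrizable_space (euclidean :: 'b topology)"
    and \<mu>: "\<And>n. borel_prob (\<mu> n)"
    and a_pos: "\<And>n. a n > 0"
    and a_lim: "filterlim a at_top sequentially"
    and \<theta>n_meas: "\<And>n. \<theta>n n \<in> borel_measurable borel"
    and \<theta>_meas: "\<theta> \<in> borel_measurable borel"
    and \<theta>_conv: "\<And>K. compact K \<Longrightarrow> uniform_limit K \<theta>n \<theta> sequentially"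
    and \<gamma>_def: "\<And>n. \<gamma> n = distr (\<mu> n) borel (\<theta>n n)"
  shows "(\<forall>I. lower_semicontinuous I \<longrightarrow> ld_lower_bound a \<mu> I \<longrightarrow>
            ld_lower_bound a \<gamma> (\<lambda>y. INF x\<in>Lambda_lower \<theta> y. I x)) \<and>
         (\<forall>I. lower_semicontinuous I \<longrightarrow> exponentially_tight a \<mu> \<longrightarrow> ld_upper_bound a \<mu> I \<longrightarrow>
            ld_weak_upper_bound a \<gamma> (\<lambda>y. INF x\<in>Lambda_upper \<theta> y. I x)) \<and>
         (\<forall>y. Lambda_lower \<theta> y \<subseteq> \<theta> -` {y} \<and> \<theta> -` {y} \<subseteq> Lambda_upper \<theta> y) \<and>
         (continuous_on UNIV \<theta> \<longrightarrow>
            (\<forall>y. Lambda_lower \<theta> y = \<theta> -` {y} \<and> Lambda_upper \<theta> y = \<theta> -` {y}))"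
proof -
  have \<gamma>: "\<gamma> = (\<lambda>n. distr (\<mu> n) borel (\<theta>n n))"
    using \<gamma>_def by auto
  show ?thesis
    unfolding \<gamma>
    using ld_lower_bound_image[of \<mu> a \<theta>n \<theta>, OF \<mu> a_pos \<theta>n_meas \<theta>_conv]
      ld_weak_upper_bound_image[of \<mu> a \<theta>n \<theta>, OF \<mu> a_pos a_lim \<theta>n_meas \<theta>_conv]
    by (simp add: Lambda_lower_subset subset_Lambda_upper
        Lambda_lower_continuous Lambda_upper_continuous)
qed

end
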